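(* Let $Q=(q_{ij})_{1\le i,j\le N}$ be an irreducible transition rate matrix with steady-state distribution $\mu=(\mu_1,\dots,\mu_N)$, let $p(0)$ be any probability distribution on $\{1,\dots,N\}$, and let $p(t)=(p_1(t),\dots,p_N(t))$ be the solution of the master equation $\frac{dp}{dt}=pQ$ with initial value $p(0)$. Let $\alpha$ be a real number with $\alpha\neq 0,1$. For every $t\ge0$, writing $p_i=p_i(t)$, the Tsallis-type free energy $$F_\alpha = \frac{1}{\alpha(\alpha-1)}\Big[\sum_ip_i\Big(\frac{p_i}{\mu_i}\Big)^{\alpha-1}-1\Big]$$ satisfies $$F_\alpha \;\ge\; \begin{cases} \dfrac{1}{2}\displaystyle\sum_i\mu_i^{1-\alpha}(p_i-\mu_i)^2, &\text{if } \alpha<2, \\[2mm] u_\alpha \displaystyle\sum_i\mu_i^{1-\alpha}|p_i-\mu_i|^{\alpha}, &\text{if } \alpha\geq 2, \end{cases}$$ where, for $\alpha\ge2$, $u_\alpha>0$ is a constant depending only on $\alpha$ such that for every complex number $z$, $$\frac{1}{\alpha(\alpha-1)}\big[|z+1|^{\alpha}-1-\alpha\,\mathrm{Re}(z)\big] \geq u_\alpha|z|^\alpha .$$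
   Context: Transition rate matrix on the finite state space $\{1,\dots,N\}$: a real matrix $Q=(q_{ij})$ with $q_{ij}\ge 0$ for $i\ne j$ and $q_{ii}=-\sum_{j\ne i}q_{ij}$. Irreducible: for each pair of states $i\neq j$ there is a sequence of states $i_1=i,i_2,\dots,i_m=j$ with $q_{i_1i_2}q_{i_2i_3}\cdots q_{i_{m-1}i_m}>0$. Under irreducibility there is a unique probability distribution $\mu$ with $\mu Q=0$ (the steady-state distribution), and all its components are positive. For any initial probability distribution $p(0)$, the solution $p(t)$ (a row vector) of $dp/dt=pQ$ is a probability distribution for all $t\ge 0$, and all its components are positive for $t>0$. If $p_i=0$, the term $p_i(p_i/\mu_i)^{\alpha-1}=\mu_i(p_i/\mu_i)^{\alpha}$ is understood in the limit sense: it is $0$ for $\alpha>0$ and $+\infty$ for $\alpha<0$ (so $F_\alpha=+\infty$ in the latter case). For each $\alpha\ge2$, a constant $u_\alpha>0$ with the stated property is known to exist (Leindler's inequality). *)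

theory Defs
  imports "HOL-Analysis.Analysis"
begin

text \<open>The state space is the arbitrary finite type \<open>'n\<close>, and the distributions are row vectors,
  so that the product of a distribution with a rate matrix is written \<open>p v* Q\<close>.\<close>

definition prob_vector :: "real ^ 'n \<Rightarrow> bool" where
  "prob_vector p \<longleftrightarrow> (\<forall>i. 0 \<le> p $ i) \<and> (\<Sum>i\<in>UNIV. p $ i) = 1"

definition transition_rate_matrix :: "real ^ 'n ^ 'n \<Rightarrow> bool" where
  "transition_rate_matrix Q \<longleftrightarrow>
     (\<forall>i j. i \<noteq> j \<longrightarrow> 0 \<le> Q $ i $ j) \<and>
     (\<forall>i. Q $ i $ i = - (\<Sum>j\<in>UNIV - {i}. Q $ i $ j))"

definition irreducible_rates :: "real ^ 'n ^ 'n \<Rightarrow> bool" where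
  "irreducible_rates Q \<longleftrightarrow>
     (\<forall>i j. i \<noteq> j \<longrightarrow>
       (\<exists>xs. xs \<noteq> [] \<and> hd xs = i \<and> last xs = j \<and>
             0 < (\<Prod>k<length xs - 1. Q $ (xs ! k) $ (xs ! Suc k))))"

definition steady_state :: "real ^ 'n ^ 'n \<Rightarrow> real ^ 'n \<Rightarrow> bool" where
  "steady_state Q \<mu> \<longleftrightarrow> prob_vector \<mu> \<and> \<mu> v* Q = 0"

text \<open>At \<open>t = 0\<close> the derivative is one-sided.\<close>

definition master_equation_solution :: "real ^ 'n ^ 'n \<Rightarrow> (real \<Rightarrow> real ^ 'n) \<Rightarrow> bool" where
  "master_equation_solution Q p \<longleftrightarrow>
     (\<forall>t\<ge>0. (p has_vector_derivative (p t v* Q)) (at t within {0..}))"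

text \<open>The summand \<open>x (x / m) powr (\<alpha> - 1)\<close>, whose value at \<open>x = 0\<close> is its limit as \<open>x\<close> decreases
  to \<open>0\<close> (for \<open>m > 0\<close> and \<open>\<alpha> \<noteq> 0\<close>). The limit may be infinite, hence the extended reals.\<close>

definition tsallis_term :: "real \<Rightarrow> real \<Rightarrow> real \<Rightarrow> ereal" where
  "tsallis_term \<alpha> m x =
     (if x = 0 then (if \<alpha> < 0 then \<infinity> else 0) else ereal (x * (x / m) powr (\<alpha> - 1)))"

definition tsallis_free_energy :: "real \<Rightarrow> real ^ 'n \<Rightarrow> real ^ 'n \<Rightarrow> ereal" where
  "tsallis_free_energy \<alpha> \<mu> p =
     ereal (1 / (\<alpha> * (\<alpha> - 1))) * ((\<Sum>i\<in>UNIV. tsallis_term \<alpha> (\<mu> $ i) (p $ i)) - 1)"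

definition leindler_constant :: "real \<Rightarrow> real \<Rightarrow> bool" where
  "leindler_constant \<alpha> u \<longleftrightarrow>
     0 < u \<and>
     (\<forall>z::complex. 1 / (\<alpha> * (\<alpha> - 1)) * (cmod (z + 1) powr \<alpha> - 1 - \<alpha> * Re z) \<ge> u * cmod z powr \<alpha>)"

end

theory Submission
  imports Defs
begin

text \<open>The vector \<open>p t\<close> stays a probability distribution, since the total mass is conserved and
  the squared norm of its negative part satisfies a Gronwall inequality. With \<open>w = p\<^sub>i / \<mu>\<^sub>i\<close>, the
  normalisations of \<open>p t\<close> and \<open>\<mu>\<close> turn the free energy into the \<open>\<mu>\<close>-mean of
  \<open>(w\<^sup>\<alpha> - 1 - \<alpha> (w - 1)) / (\<alpha> (\<alpha> - 1))\<close>, so the bound may be proved term by term.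
  For \<open>\<alpha> < 2\<close> the second derivative \<open>w\<^sup>\<alpha>\<^sup>-\<^sup>2\<close> of this function is at least \<open>\<mu>\<^sub>i\<^sup>2\<^sup>-\<^sup>\<alpha>\<close>,
  because \<open>p\<^sub>i \<le> 1\<close> gives \<open>w \<le> 1 / \<mu>\<^sub>i\<close>; for \<open>\<alpha> \<ge> 2\<close> apply Leindler's inequality to \<open>z = w - 1\<close>.\<close>

section \<open>A Gronwall inequality and the square of the negative part\<close>

text \<open>The integrating factor \<open>exp (- C * s)\<close> turns the differential inequality
  into a nonpositive derivative, so the mean value theorem on \<open>{0..t}\<close> bounds the
  weighted function by its initial value.\<close>

lemma gronwall_nonpos:
  fixes f f' :: "real \<Rightarrow> real"
  assumes der: "\<And>s. 0 \<le> s \<Longrightarrow> (f has_real_derivative f' s) (at s within {0..})"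
    and le: "\<And>s. 0 \<le> s \<Longrightarrow> f' s \<le> C * f s"
    and "f 0 \<le> 0" "0 \<le> t"
  shows "f t \<le> 0"
proof (cases "t = 0")
  case False
  define g where "g s = exp (- C * s) * f s" for s
  have g: "(g has_real_derivative exp (- C * s) * (f' s - C * f s)) (at s within {0..t})"
    if "0 \<le> s" for s
  proof -
    have "(f has_real_derivative f' s) (at s within {0..t})"
      using der[OF that] by (rule DERIV_subset) auto
    then show ?thesis
      unfolding g_def by (auto intro!: derivative_eq_intros simp: algebra_simps)
  qed
  have "\<exists>x\<in>{0<..<t}. g t - g 0 = exp (- C * x) * (f' x - C * f x) * (t - 0)"
    by (rule mvt_simple) (use False \<open>0 \<le> t\<close> g in \<open>auto simp: has_field_derivative_def\<close>)
  then obtain x where x: "0 < x" "x < t"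
    and eq: "g t - g 0 = exp (- C * x) * (f' x - C * f x) * (t - 0)"
    by auto
  have "exp (- C * x) * (f' x - C * f x) * (t - 0) \<le> 0"
    using le[of x] x by (simp add: mult_le_0_iff)
  with eq \<open>f 0 \<le> 0\<close> have "g t \<le> 0"
    by (simp add: g_def)
  then show ?thesis
    by (simp add: g_def mult_le_0_iff)
qed (use assms in simp)

text \<open>Squaring removes the kink of \<open>min x 0\<close>: at 0 the difference quotient is at
  most \<open>\<bar>h\<bar>\<close> in absolute value.\<close>

lemma has_real_derivative_square_min_0:
  "((\<lambda>x::real. (min x 0)\<^sup>2) has_real_derivative 2 * min x 0) (at x)"
proof -
  consider "x < 0" | "x = 0" | "0 < x" by linarith
  then show ?thesis
  proof cases
    case 1
    have "((\<lambda>x::real. x\<^sup>2) has_real_derivative 2 * min x 0) (at x)"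
      using 1 by (auto intro!: derivative_eq_intros)
    then show ?thesis
      by (rule has_field_derivative_transform_within_open[of _ _ _ "{..<0}"]) (use 1 in auto)
  next
    case 2
    have "((\<lambda>h::real. (min h 0)\<^sup>2 / h) \<longlongrightarrow> 0) (at 0)"
    proof (rule Lim_null_comparison)
      show "\<forall>\<^sub>F h in at 0. norm ((min h 0)\<^sup>2 / h) \<le> \<bar>h\<bar>"
        by (auto simp: eventually_at_filter min_def power2_eq_square)
      show "((\<lambda>h::real. \<bar>h\<bar>) \<longlongrightarrow> 0) (at 0)"
        by (rule tendsto_eq_intros | simp)+
    qed
    then show ?thesis
      using 2 by (simp add: DERIV_def)
  next
    case 3
    have "((\<lambda>x::real. 0) has_real_derivative 2 * min x 0) (at x)"
      using 3 by (auto intro!: derivative_eq_intros)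
    then show ?thesis
      by (rule has_field_derivative_transform_within_open[of _ _ _ "{0<..}"]) (use 3 in auto)
  qed
qed

section \<open>Invariance of probability vectors under the master equation\<close>

lemma transition_rate_matrix_row_sum:
  assumes "transition_rate_matrix Q"
  shows "(\<Sum>j\<in>UNIV. Q $ i $ j) = 0"
  using assms by (simp add: transition_rate_matrix_def sum.remove[of UNIV i])

lemma vector_rate_matrix_sum_eq_0:
  assumes "transition_rate_matrix Q"
  shows "(\<Sum>j\<in>UNIV. (x v* Q) $ j) = 0"
proof -
  have "(\<Sum>j\<in>UNIV. (x v* Q) $ j) = (\<Sum>j\<in>UNIV. \<Sum>i\<in>UNIV. x $ i * Q $ i $ j)"
    by (simp add: vector_matrix_mult_def mult.commute)
  also have "\<dots> = (\<Sum>i\<in>UNIV. x $ i * (\<Sum>j\<in>UNIV. Q $ i $ j))"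
    by (subst sum.swap) (simp add: sum_distrib_left)
  finally show ?thesis
    by (simp add: transition_rate_matrix_row_sum[OF assms])
qed

text \<open>The left side is the time derivative of the squared norm of the negative part along the
  flow, so this is the hypothesis of the Gronwall inequality. The constant is crude: every entry of
  \<open>Q\<close> is replaced by its absolute value.\<close>

lemma negative_part_rate_le:
  fixes x :: "real ^ 'n"
  assumes "transition_rate_matrix Q"
  shows "(\<Sum>j\<in>UNIV. 2 * min (x $ j) 0 * (x v* Q) $ j)
    \<le> 2 * (\<Sum>j\<in>UNIV. \<Sum>i\<in>UNIV. \<bar>Q $ i $ j\<bar>) * (\<Sum>j\<in>UNIV. (min (x $ j) 0)\<^sup>2)"
proof -
  define n where "n j = min (x $ j) 0" for j
  define V where "V = (\<Sum>j\<in>UNIV. (n j)\<^sup>2)"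
  have V: "(n j)\<^sup>2 \<le> V" for j
    unfolding V_def by (rule member_le_sum) auto
  have nn: "n i * n j \<le> V" for i j
    using sum_squares_bound[of "n i" "n j"] V[of i] V[of j] by linarith
  have n0: "n j \<le> 0" for j
    by (simp add: n_def)
  have "n j * (Q $ i $ j * x $ i) \<le> \<bar>Q $ i $ j\<bar> * V" for i j
  proof (cases "i = j")
    case True
    have "n j * (Q $ i $ j * x $ i) = Q $ i $ j * (n j)\<^sup>2"
      using True by (simp add: n_def min_def power2_eq_square)
    also have "\<dots> \<le> \<bar>Q $ i $ j\<bar> * V"
      by (intro mult_mono V) auto
    finally show ?thesis .
  next
    case False
    then have q: "0 \<le> Q $ i $ j"
      using assms by (simp add: transition_rate_matrix_def)
    \<comment> \<open>Multiplying \<open>n i \<le> x $ i\<close> by \<open>n j \<le> 0\<close>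
      reverses it: a positive part of \<open>x\<close> can only lower the rate, since the
      off-diagonal entries are nonnegative.\<close>
    have "n j * x $ i \<le> n j * n i"
      using n0[of j] by (intro mult_left_mono_neg) (auto simp: n_def)
    then have "Q $ i $ j * (n j * x $ i) \<le> Q $ i $ j * V"
      using nn[of j i] q by (intro mult_left_mono) auto
    then show ?thesis
      using q by (simp add: mult_ac)
  qed
  then have "(\<Sum>j\<in>UNIV. \<Sum>i\<in>UNIV. n j * (Q $ i $ j * x $ i))
      \<le> (\<Sum>j\<in>UNIV. \<Sum>i\<in>UNIV. \<bar>Q $ i $ j\<bar> * V)"
    by (intro sum_mono)
  moreover have "(\<Sum>j\<in>UNIV. 2 * n j * (x v* Q) $ j)
      = 2 * (\<Sum>j\<in>UNIV. \<Sum>i\<in>UNIV. n j * (Q $ i $ j * x $ i))"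
    by (simp add: vector_matrix_mult_def sum_distrib_left mult_ac)
  ultimately show ?thesis
    unfolding V_def n_def by (simp flip: sum_distrib_right)
qed

lemma master_equation_component:
  assumes "master_equation_solution Q p" "0 \<le> t"
  shows "((\<lambda>s. p s $ j) has_real_derivative (p t v* Q) $ j) (at t within {0..})"
  using assms bounded_linear.has_vector_derivative[OF bounded_linear_vec_nth]
  by (fastforce simp: master_equation_solution_def has_real_derivative_iff_has_vector_derivative)

lemma master_equation_nonneg:
  fixes Q :: "real ^ 'n ^ 'n"
  assumes Q: "transition_rate_matrix Q" and p: "master_equation_solution Q p"
    and "\<And>j. 0 \<le> p 0 $ j" "0 \<le> t"
  shows "0 \<le> p t $ j"
proof -
  have "(\<Sum>j\<in>UNIV. (min (p t $ j) 0)\<^sup>2) \<le> 0"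
  proof (rule gronwall_nonpos[where f = "\<lambda>s. \<Sum>j\<in>UNIV. (min (p s $ j) 0)\<^sup>2"])
    show "((\<lambda>s. \<Sum>j\<in>UNIV. (min (p s $ j) 0)\<^sup>2) has_real_derivative
        (\<Sum>j\<in>UNIV. 2 * min (p s $ j) 0 * (p s v* Q) $ j)) (at s within {0..})"
      if "0 \<le> s" for s
      by (intro DERIV_sum DERIV_chain2[OF has_real_derivative_square_min_0]
          master_equation_component p that)
  qed (use assms negative_part_rate_le[OF Q] in auto)
  then have "(\<Sum>j\<in>UNIV. (min (p t $ j) 0)\<^sup>2) = 0"
    by (simp add: antisym sum_nonneg)
  then have "(min (p t $ j) 0)\<^sup>2 = 0"
    by (simp add: sum_nonneg_eq_0_iff)
  then show ?thesis
    by (simp add: min_def split: if_splits)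
qed

lemma master_equation_mass:
  assumes Q: "transition_rate_matrix Q" and p: "master_equation_solution Q p" and "0 \<le> t"
  shows "(\<Sum>j\<in>UNIV. p t $ j) = (\<Sum>j\<in>UNIV. p 0 $ j)"
proof -
  have der: "((\<lambda>s. \<Sum>j\<in>UNIV. p s $ j) has_real_derivative 0) (at s within {0..})"
    if "0 \<le> s" for s
  proof -
    have "((\<lambda>s. \<Sum>j\<in>UNIV. p s $ j) has_real_derivative (\<Sum>j\<in>UNIV. (p s v* Q) $ j))
        (at s within {0..})"
      by (intro DERIV_sum master_equation_component p that)
    then show ?thesis
      by (simp only: vector_rate_matrix_sum_eq_0[OF Q])
  qed
  have "\<exists>c. \<forall>s\<in>{0..}. (\<Sum>j\<in>UNIV. p s $ j) = c"
    by (rule has_field_derivative_zero_constant) (use der in auto)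
  then show ?thesis
    using \<open>0 \<le> t\<close> by auto
qed

lemma master_equation_prob_vector:
  assumes "transition_rate_matrix Q" "master_equation_solution Q p" "prob_vector (p 0)" "0 \<le> t"
  shows "prob_vector (p t)"
  using assms master_equation_nonneg[OF assms(1,2) _ assms(4)]
    master_equation_mass[OF assms(1,2,4)]
  by (simp add: prob_vector_def)

section \<open>Positivity of the steady state\<close>

text \<open>In the balance equation at \<open>j\<close> the diagonal term vanishes with
  \<open>\<mu> $ j\<close>, and the other terms are nonnegative with sum 0, so each is 0.\<close>

lemma steady_state_zero_backward:
  assumes "transition_rate_matrix Q" "steady_state Q \<mu>" "\<mu> $ j = 0" "Q $ i $ j \<noteq> 0"
  shows "\<mu> $ i = 0"
proof (cases "i = j")
  case False
  have Q: "0 \<le> Q $ k $ j" if "k \<noteq> j" for k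
    using assms that by (simp add: transition_rate_matrix_def)
  have mu: "0 \<le> \<mu> $ k" for k
    using assms by (simp add: steady_state_def prob_vector_def)
  have "(\<mu> v* Q) $ j = 0"
    using assms by (simp add: steady_state_def)
  then have "(\<Sum>k\<in>UNIV. Q $ k $ j * \<mu> $ k) = 0"
    by (simp add: vector_matrix_mult_def mult.commute)
  moreover have "0 \<le> Q $ k $ j * \<mu> $ k" for k
    using Q[of k] mu[of k] \<open>\<mu> $ j = 0\<close> by (cases "k = j") auto
  ultimately have "Q $ i $ j * \<mu> $ i = 0"
    by (simp add: sum_nonneg_eq_0_iff)
  then show ?thesis
    using assms by simp
qed (use assms in simp)

text \<open>A zero at \<open>j\<close> would spread backward along the paths leading to
  \<open>j\<close>, hence to all states, contradicting total mass 1.\<close>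

lemma steady_state_pos:
  assumes Q: "transition_rate_matrix Q" and irr: "irreducible_rates Q" and \<mu>: "steady_state Q \<mu>"
  shows "0 < \<mu> $ j"
proof (rule ccontr)
  assume "\<not> 0 < \<mu> $ j"
  moreover have "0 \<le> \<mu> $ j"
    using \<mu> by (simp add: steady_state_def prob_vector_def)
  ultimately have j: "\<mu> $ j = 0"
    by simp
  have "\<mu> $ i = 0" for i
  proof (cases "i = j")
    case False
    then obtain xs where xs: "xs \<noteq> []" "hd xs = i" "last xs = j"
      and pos: "0 < (\<Prod>k<length xs - 1. Q $ (xs ! k) $ (xs ! Suc k))"
      using irr unfolding irreducible_rates_def by blast
    \<comment> \<open>A positive product only makes its factors nonzero: a state repeated in
      succession contributes a diagonal entry, which may be negative.\<close>
    have step: "Q $ (xs ! k) $ (xs ! Suc k) \<noteq> 0" if "k < length xs - 1" for k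
      using pos that by (metis finite_lessThan lessThan_iff less_irrefl prod_zero)
    have "\<mu> $ (xs ! 0) = 0"
    proof (rule inc_induct[of 0 "length xs - 1" "\<lambda>k. \<mu> $ (xs ! k) = 0"])
      show "\<mu> $ (xs ! (length xs - 1)) = 0"
        using xs j by (simp add: last_conv_nth)
    qed (use step steady_state_zero_backward[OF Q \<mu>] in auto)
    then show ?thesis
      using xs by (simp add: hd_conv_nth)
  qed (use j in simp)
  then show False
    using \<mu> by (simp add: steady_state_def prob_vector_def)
qed

section \<open>Lower bounds for a single summand\<close>

text \<open>On \<open>{0<..b}\<close> the second derivative \<open>x powr (\<alpha> - 2)\<close> of
  the normalised power is at least its value at \<open>b\<close>, the exponent being negative.
  Subtracting the matching quadratic therefore leaves a convex function \<open>g\<close>.\<close>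

lemma powr_tangent_quadratic_bound:
  fixes \<alpha> b w :: real
  assumes "\<alpha> < 2" "\<alpha> \<noteq> 0" "\<alpha> \<noteq> 1" "0 < w" "w \<le> b" "1 \<le> b"
  shows "1 / 2 * b powr (\<alpha> - 2) * (w - 1)\<^sup>2
    \<le> (w powr \<alpha> - 1 - \<alpha> * (w - 1)) / (\<alpha> * (\<alpha> - 1))"
proof -
  define c where "c = b powr (\<alpha> - 2)"
  define g where "g w = w powr \<alpha> / (\<alpha> * (\<alpha> - 1)) - c / 2 * (w - 1)\<^sup>2" for w :: real
  define g' where "g' w = w powr (\<alpha> - 1) / (\<alpha> - 1) - c * (w - 1)" for w :: real
  have 1: "(g has_real_derivative g' x) (at x)" if "0 < x" for x
  proof -
    have "((\<lambda>x. x powr \<alpha> / (\<alpha> * (\<alpha> - 1))) has_real_derivative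
        \<alpha> * x powr (\<alpha> - 1) / (\<alpha> * (\<alpha> - 1))) (at x)"
      by (intro DERIV_cdivide has_real_derivative_powr that)
    moreover have "((\<lambda>x. c / 2 * (x - 1)\<^sup>2) has_real_derivative c * (x - 1)) (at x)"
      by (auto intro!: derivative_eq_intros)
    ultimately show ?thesis
      unfolding g_def g'_def using DERIV_diff assms by fastforce
  qed
  have 2: "(g' has_real_derivative x powr (\<alpha> - 2) - c) (at x)" if "0 < x" for x
  proof -
    have "((\<lambda>x. x powr (\<alpha> - 1) / (\<alpha> - 1)) has_real_derivative
        (\<alpha> - 1) * x powr (\<alpha> - 1 - 1) / (\<alpha> - 1)) (at x)"
      by (intro DERIV_cdivide has_real_derivative_powr that)
    moreover have "((\<lambda>x. c * (x - 1)) has_real_derivative c) (at x)"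
      by (auto intro!: derivative_eq_intros)
    ultimately show ?thesis
      unfolding g'_def using DERIV_diff assms by fastforce
  qed
  \<comment> \<open>The convex \<open>g\<close> lies above its tangent at 1, a point of the interval
    because \<open>1 \<le> b\<close>. The quadratic contributes neither value nor slope
    there.\<close>
  have "g' 1 * (w - 1) \<le> g w - g 1"
  proof (rule f''_imp_f'[of "{0<..b}" g g' "\<lambda>x. x powr (\<alpha> - 2) - c"])
    show "0 \<le> x powr (\<alpha> - 2) - c" if "x \<in> {0<..b}" for x
      unfolding c_def using that assms by (auto intro!: powr_mono2')
  qed (use assms 1 2 in \<open>auto simp: convex_real_interval\<close>)
  moreover have "g' 1 = 1 / (\<alpha> - 1)" "g 1 = 1 / (\<alpha> * (\<alpha> - 1))"
    by (simp_all add: g_def g'_def)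
  ultimately have "1 / (\<alpha> - 1) * (w - 1) \<le> g w - 1 / (\<alpha> * (\<alpha> - 1))"
    by simp
  then have "c / 2 * (w - 1)\<^sup>2
      \<le> w powr \<alpha> / (\<alpha> * (\<alpha> - 1)) - 1 / (\<alpha> * (\<alpha> - 1)) - 1 / (\<alpha> - 1) * (w - 1)"
    unfolding g_def by linarith
  also have "1 / (\<alpha> - 1) * (w - 1) = \<alpha> * (w - 1) / (\<alpha> * (\<alpha> - 1))"
    using assms by simp
  finally show ?thesis
    unfolding c_def diff_divide_distrib[of "_ - _"] diff_divide_distrib[of _ 1] by simp
qed

text \<open>For \<open>x > 0\<close> this is \<open>m\<close> times the preceding bound at
  \<open>w = x / m\<close> with \<open>b = 1 / m\<close>; \<open>x \<le> 1\<close> gives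
  \<open>w \<le> b\<close>, and \<open>m \<le> 1\<close> gives \<open>1 \<le> b\<close>. The
  endpoint \<open>x = 0\<close>, where \<alpha> is positive, is computed directly.\<close>

lemma tsallis_term_lower_quadratic:
  fixes m x \<alpha> :: real
  assumes "\<alpha> < 2" "\<alpha> \<noteq> 0" "\<alpha> \<noteq> 1" "0 < m" "m \<le> 1" "0 \<le> x" "x \<le> 1" "\<alpha> < 0 \<Longrightarrow> x \<noteq> 0"
  shows "1 / 2 * (m powr (1 - \<alpha>) * (x - m)\<^sup>2)
    \<le> (x * (x / m) powr (\<alpha> - 1) - m - \<alpha> * (x - m)) / (\<alpha> * (\<alpha> - 1))"
proof (cases "x = 0")
  case True
  with assms have "0 < \<alpha>" by force
  have "1 / 2 * (m powr (1 - \<alpha>) * m\<^sup>2) = 1 / 2 * (m * m powr (2 - \<alpha>))"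
    using assms powr_add[of m "1 - \<alpha>" 1] by (simp add: power2_eq_square)
  also have "\<dots> \<le> 1 / 2 * (m * 1)"
    using assms by (intro mult_left_mono powr_le1) auto
  \<comment> \<open>This is 1/2 \<le> 1/\<alpha>, from 0 < \<alpha> < 2.\<close>
  also have "\<dots> \<le> m / \<alpha>"
    using assms \<open>0 < \<alpha>\<close> by (simp add: field_simps)
  also have "\<dots> = (\<alpha> * m - m) / (\<alpha> * (\<alpha> - 1))"
    using assms by (simp add: field_simps)
  finally show ?thesis
    using True by simp
next
  case False
  with assms have x: "0 < x" by simp
  have "m * (1 / 2 * (1 / m) powr (\<alpha> - 2) * (x / m - 1)\<^sup>2)
      \<le> m * (((x / m) powr \<alpha> - 1 - \<alpha> * (x / m - 1)) / (\<alpha> * (\<alpha> - 1)))"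
    using assms x
    by (intro mult_left_mono powr_tangent_quadratic_bound) (auto simp: divide_right_mono)
  also have "m * (((x / m) powr \<alpha> - 1 - \<alpha> * (x / m - 1)) / (\<alpha> * (\<alpha> - 1)))
      = (x * (x / m) powr (\<alpha> - 1) - m - \<alpha> * (x - m)) / (\<alpha> * (\<alpha> - 1))"
    using assms x by (simp add: powr_diff algebra_simps)
  also have "m * (1 / 2 * (1 / m) powr (\<alpha> - 2) * (x / m - 1)\<^sup>2)
      = 1 / 2 * (m powr (1 - \<alpha>) * (x - m)\<^sup>2)"
  proof -
    have "(x / m - 1)\<^sup>2 = (x - m)\<^sup>2 / m\<^sup>2"
      using assms by (simp add: diff_divide_distrib flip: power_divide)
    moreover have "(1 / m) powr (\<alpha> - 2) = m * m powr (1 - \<alpha>)"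
      using assms powr_add[of m 1 "1 - \<alpha>"] by (simp add: powr_divide flip: powr_minus_divide)
    ultimately show ?thesis
      using assms by (simp add: power2_eq_square)
  qed
  finally show ?thesis .
qed

text \<open>Leindler's inequality at the real point \<open>z = x / m - 1\<close>, multiplied by
  \<open>m\<close>; \<open>x \<ge> 0\<close> makes \<open>\<bar>z + 1\<bar>\<close> equal to
  \<open>x / m\<close>.\<close>

lemma tsallis_term_lower_leindler:
  fixes m x \<alpha> u :: real
  assumes "leindler_constant \<alpha> u" "0 < m" "0 \<le> x"
  shows "u * (m powr (1 - \<alpha>) * \<bar>x - m\<bar> powr \<alpha>)
    \<le> (x * (x / m) powr (\<alpha> - 1) - m - \<alpha> * (x - m)) / (\<alpha> * (\<alpha> - 1))"
proof -
  define z where "z = x / m - 1"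
  have "u * \<bar>z\<bar> powr \<alpha> \<le> 1 / (\<alpha> * (\<alpha> - 1)) * (\<bar>z + 1\<bar> powr \<alpha> - 1 - \<alpha> * z)"
  proof -
    have "complex_of_real z + 1 = complex_of_real (z + 1)"
      by simp
    then have "cmod (complex_of_real z + 1) = \<bar>z + 1\<bar>"
      by (simp only: norm_of_real)
    with assms(1) show ?thesis
      unfolding leindler_constant_def by (metis Re_complex_of_real norm_of_real)
  qed
  then have "m * (u * \<bar>z\<bar> powr \<alpha>) \<le> m * (1 / (\<alpha> * (\<alpha> - 1)) * (\<bar>z + 1\<bar> powr \<alpha> - 1 - \<alpha> * z))"
    using assms by (intro mult_left_mono) auto
  also have "\<dots> = (m * \<bar>z + 1\<bar> powr \<alpha> - m - \<alpha> * (m * z)) / (\<alpha> * (\<alpha> - 1))"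
    by (simp add: right_diff_distrib diff_divide_distrib mult.left_commute)
  also have "m * z = x - m"
    using assms by (simp add: z_def right_diff_distrib)
  also have "\<bar>z + 1\<bar> = x / m"
    using assms by (simp add: z_def)
  \<comment> \<open>At \<open>x = 0\<close> both sides vanish because
    \<open>0 powr \<alpha> = 0\<close>.\<close>
  also have "m * (x / m) powr \<alpha> = x * (x / m) powr (\<alpha> - 1)"
    using assms by (cases "x = 0") (auto simp: powr_diff)
  also have "m * (u * \<bar>z\<bar> powr \<alpha>) = u * (m powr (1 - \<alpha>) * \<bar>x - m\<bar> powr \<alpha>)"
  proof -
    have "\<bar>z\<bar> = \<bar>x - m\<bar> / m"
      using assms by (simp add: z_def abs_if field_simps)
    then show ?thesis
      using assms by (simp add: powr_divide powr_diff)
  qed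
  finally show ?thesis .
qed

section \<open>From single summands to the free energy\<close>

lemma tsallis_free_energy_infinite:
  assumes "\<alpha> < 0" "x $ k = 0"
  shows "tsallis_free_energy \<alpha> \<mu> x = \<infinity>"
proof -
  have "(\<Sum>i\<in>UNIV. tsallis_term \<alpha> (\<mu> $ i) (x $ i)) = \<infinity>"
    unfolding sum_Pinfty using assms by (auto simp: tsallis_term_def)
  \<comment> \<open>A positive prefactor keeps the infinite sum at plus infinity.\<close>
  moreover have "0 < \<alpha> * (\<alpha> - 1)"
    using assms by (simp add: mult_neg_neg)
  ultimately show ?thesis
    using assms by (simp add: tsallis_free_energy_def)
qed

text \<open>The subtracted \<open>\<mu> $ i\<close> sum to 1 and the linear terms sum to 0, so the
  summands take the form of the pointwise bounds.\<close>

lemma tsallis_free_energy_finite: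
  assumes "\<And>k. \<alpha> < 0 \<Longrightarrow> x $ k \<noteq> 0" "prob_vector \<mu>" "prob_vector x"
  shows "tsallis_free_energy \<alpha> \<mu> x = ereal (\<Sum>i\<in>UNIV.
    (x $ i * (x $ i / \<mu> $ i) powr (\<alpha> - 1) - \<mu> $ i - \<alpha> * (x $ i - \<mu> $ i)) / (\<alpha> * (\<alpha> - 1)))"
proof -
  have "tsallis_term \<alpha> (\<mu> $ i) (x $ i) = ereal (x $ i * (x $ i / \<mu> $ i) powr (\<alpha> - 1))" for i
    using assms(1)[of i] by (auto simp: tsallis_term_def)
  then have "tsallis_free_energy \<alpha> \<mu> x
      = ereal (((\<Sum>i\<in>UNIV. x $ i * (x $ i / \<mu> $ i) powr (\<alpha> - 1)) - 1) / (\<alpha> * (\<alpha> - 1)))"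
    by (simp add: tsallis_free_energy_def one_ereal_def)
  then show ?thesis
    using assms(2,3)
    by (simp add: prob_vector_def sum_subtractf flip: sum_divide_distrib sum_distrib_left)
qed

theorem theorem3p17:
  fixes Q :: "real ^ 'n ^ 'n"
    and \<mu> :: "real ^ 'n"
    and p :: "real \<Rightarrow> real ^ 'n"
    and \<alpha> u t :: real
  assumes "transition_rate_matrix Q"
    and "irreducible_rates Q"
    and "steady_state Q \<mu>"
    and "prob_vector (p 0)"
    and "master_equation_solution Q p"
    and "\<alpha> \<noteq> 0" and "\<alpha> \<noteq> 1"
    and "\<alpha> \<ge> 2 \<Longrightarrow> leindler_constant \<alpha> u"
    and "t \<ge> 0"
  shows "tsallis_free_energy \<alpha> \<mu> (p t) \<ge>
    ereal (if \<alpha> < 2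
           then 1 / 2 * (\<Sum>i\<in>UNIV. (\<mu> $ i) powr (1 - \<alpha>) * (p t $ i - \<mu> $ i)\<^sup>2)
           else u * (\<Sum>i\<in>UNIV. (\<mu> $ i) powr (1 - \<alpha>) * \<bar>p t $ i - \<mu> $ i\<bar> powr \<alpha>))"
proof -
  have \<mu>: "prob_vector \<mu>"
    using assms by (simp add: steady_state_def)
  have x: "prob_vector (p t)"
    using assms by (auto intro: master_equation_prob_vector[of Q])
  have pos: "0 < \<mu> $ i" for i
    using assms by (auto intro: steady_state_pos[of Q])
  have le1: "v $ i \<le> 1" if "prob_vector v" for v :: "real ^ 'n" and i
    using that member_le_sum[of i UNIV "\<lambda>i. v $ i"] by (simp add: prob_vector_def)
  have x0: "0 \<le> p t $ i" for i
    using x by (simp add: prob_vector_def)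
  show ?thesis
  \<comment> \<open>In the first case the free energy is infinite and the bound is trivial; in the
    second all summands are finite and can be compared as reals.\<close>
  proof (cases "\<alpha> < 0 \<and> (\<exists>k. p t $ k = 0)")
    case True
    then show ?thesis
      by (auto simp: tsallis_free_energy_infinite)
  next
    case False
    then have "tsallis_free_energy \<alpha> \<mu> (p t) = ereal (\<Sum>i\<in>UNIV. (p t $ i *
        (p t $ i / \<mu> $ i) powr (\<alpha> - 1) - \<mu> $ i - \<alpha> * (p t $ i - \<mu> $ i)) / (\<alpha> * (\<alpha> - 1)))"
      by (intro tsallis_free_energy_finite \<mu> x) blast
    moreover have "1 / 2 * (\<mu> $ i powr (1 - \<alpha>) * (p t $ i - \<mu> $ i)\<^sup>2)
        \<le> (p t $ i * (p t $ i / \<mu> $ i) powr (\<alpha> - 1) - \<mu> $ i - \<alpha> * (p t $ i - \<mu> $ i))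
          / (\<alpha> * (\<alpha> - 1))" if "\<alpha> < 2" for i
      using that False assms pos x0 le1[OF \<mu>] le1[OF x]
      by (intro tsallis_term_lower_quadratic) auto
    moreover have "u * (\<mu> $ i powr (1 - \<alpha>) * \<bar>p t $ i - \<mu> $ i\<bar> powr \<alpha>)
        \<le> (p t $ i * (p t $ i / \<mu> $ i) powr (\<alpha> - 1) - \<mu> $ i - \<alpha> * (p t $ i - \<mu> $ i))
          / (\<alpha> * (\<alpha> - 1))" if "\<not> \<alpha> < 2" for i
      using that assms pos x0 by (intro tsallis_term_lower_leindler) auto
    ultimately show ?thesis
      by (simp only: sum_distrib_left ereal_less_eq if_split) (auto intro!: sum_mono)
  qed
qed

end
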